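(* Let $\mathcal A$ be a finite set of $m\ge2$ alternatives, $n\ge2$, $0<\varphi<1$, and consider Condorcet's model with dispersion $\varphi$ and $n$ i.i.d. samples. Let $a\in\mathcal A$. For any $0<\alpha<1$, the following test is a level-$\alpha$ UMP test for $H_0=\mathcal B(\mathcal A)\setminus H_1$ vs. $H_1=R_{a\succ\text{others}}$: for every $n$-profile $P_n\in\mathcal B(\mathcal A)^n$, $$g_{\alpha,a}(P_n)=\begin{cases}1&\text{if }\mathrm{Ratio}(P_n)>K_\alpha\\ 0&\text{if }\mathrm{Ratio}(P_n)<K_\alpha\\ \Gamma_\alpha&\text{if }\mathrm{Ratio}(P_n)=K_\alpha,\end{cases}\qquad \mathrm{Ratio}(P_n)=\frac{m-1}{\sum_{b\ne a}\varphi^{w_{P_n}(a\succ b)}},$$ where $K_\alpha\in\mathbb R$ and $\Gamma_\alpha\in[0,1]$ are chosen such that the level (size) of $g_{\alpha,a}$ is $\alpha$.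
   Context: $\mathcal B(\mathcal A)$ is the set of all irreflexive, antisymmetric, total binary relations over $\mathcal A$ (for each pair of distinct alternatives exactly one is preferred to the other; transitivity is not required); $b\succ_V c$ means $b$ is preferred to $c$ in $V$. $R_{a\succ\text{others}}=\{V\in\mathcal B(\mathcal A): a\succ_V b\text{ for all }b\ne a\}$. $\mathrm{KT}(V,W)$ is the number of unordered pairs of alternatives on which $V,W\in\mathcal B(\mathcal A)$ disagree. Condorcet's model with fixed dispersion $\varphi$: sample space $\mathcal B(\mathcal A)^n$, parameter space $\mathcal B(\mathcal A)$; given parameter $W$, the $n$ relations are i.i.d. with $\pi_W(V)=\frac1Z\varphi^{\mathrm{KT}(V,W)}$, $Z$ the normalization factor. For a profile $P$, $P(b\succ c)$ is the number of votes in $P$ in which $b$ is preferred to $c$; $w_P(b\succ c)=P(b\succ c)-P(c\succ b)$. Testing: for disjoint sets of parameters $H_0,H_1$, a (randomized) test is a function $f$ from the sample space to $[0,1]$ ($f(P)$ is the probability of rejecting $H_0$). $\mathrm{Size}(f,h_0)=E_{P\sim\pi_{h_0}}f(P)$, $\mathrm{Size}(f)=\sup_{h_0\in H_0}\mathrm{Size}(f,h_0)$, and $\mathrm{Power}(f,h_1)=E_{P\sim\pi_{h_1}}f(P)$ for $h_1\in H_1$. A level-$\alpha$ uniformly most powerful (UMP) test for $H_0$ vs. $H_1$ is a test $f$ with $\mathrm{Size}(f)=\alpha$ such that for every $h_1\in H_1$ and every test $g$ with $\mathrm{Size}(g)\le\alpha$, $\mathrm{Power}(f,h_1)\ge\mathrm{Power}(g,h_1)$.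 *)

theory Defs
  imports "HOL-Probability.Probability"
begin

text \<open>\<open>(b, c) \<in> V\<close> reads ``\<open>b\<close> is preferred to \<open>c\<close> in \<open>V\<close>''.\<close>

definition prefs :: "'a set \<Rightarrow> 'a rel set" where
  "prefs A = {V. V \<subseteq> A \<times> A \<and> irrefl V \<and> antisym V \<and> total_on A V}"

definition prefs_top :: "'a set \<Rightarrow> 'a \<Rightarrow> 'a rel set" where
  "prefs_top A a = {V \<in> prefs A. \<forall>b \<in> A - {a}. (a, b) \<in> V}"

text \<open>For relations in \<^term>\<open>prefs A\<close>, disagreement on \<open>(b, c)\<close> and on \<open>(c, b)\<close> is the same thing;
  collecting the two-element sets \<open>{b, c}\<close> counts each unordered pair once.\<close>

definition KT :: "'a set \<Rightarrow> 'a rel \<Rightarrow> 'a rel \<Rightarrow> nat" where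
  "KT A V W = card {{b, c} | b c. b \<in> A \<and> c \<in> A \<and> b \<noteq> c \<and> ((b, c) \<in> V) \<noteq> ((b, c) \<in> W)}"

definition condorcet_Z :: "'a set \<Rightarrow> real \<Rightarrow> 'a rel \<Rightarrow> real" where
  "condorcet_Z A \<phi> W = (\<Sum>V \<in> prefs A. \<phi> ^ KT A V W)"

definition condorcet_pmf :: "'a set \<Rightarrow> real \<Rightarrow> 'a rel \<Rightarrow> 'a rel pmf" where
  "condorcet_pmf A \<phi> W =
     embed_pmf (\<lambda>V. if V \<in> prefs A then \<phi> ^ KT A V W / condorcet_Z A \<phi> W else 0)"

definition profiles :: "'a set \<Rightarrow> nat \<Rightarrow> 'a rel list set" where
  "profiles A n = {P. length P = n \<and> set P \<subseteq> prefs A}"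

definition condorcet_model :: "'a set \<Rightarrow> real \<Rightarrow> nat \<Rightarrow> 'a rel \<Rightarrow> 'a rel list pmf" where
  "condorcet_model A \<phi> n W = replicate_pmf n (condorcet_pmf A \<phi> W)"

lemma finite_prefs:
  assumes "finite A"
  shows "finite (prefs A)"
  by (rule finite_subset[of _ "Pow (A \<times> A)"]) (use assms in \<open>auto simp: prefs_def\<close>)

lemma prefs_nonempty: "prefs A \<noteq> {}"
proof -
  obtain r where r: "well_order_on A r"
    using well_order_on by blast
  then have "r \<subseteq> A \<times> A" "antisym r" "total_on A r"
    by (auto simp: order_on_defs refl_on_def)
  then have "r - Id \<in> prefs A"
    by (auto simp: prefs_def irrefl_def antisym_def total_on_def)
  then show ?thesis by blast
qed

lemma condorcet_Z_pos:
  assumes "finite A" "\<phi> > 0"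
  shows "condorcet_Z A \<phi> W > 0"
  unfolding condorcet_Z_def using assms
  by (intro sum_pos finite_prefs prefs_nonempty) auto

lemma pmf_condorcet:
  assumes "finite A" "\<phi> > 0"
  shows "pmf (condorcet_pmf A \<phi> W) V =
    (if V \<in> prefs A then \<phi> ^ KT A V W / condorcet_Z A \<phi> W else 0)"
proof -
  define f where "f V = (if V \<in> prefs A then \<phi> ^ KT A V W / condorcet_Z A \<phi> W else 0)" for V
  have Z: "condorcet_Z A \<phi> W > 0" using assms by (rule condorcet_Z_pos)
  have nn: "f V \<ge> 0" for V using Z assms by (auto simp: f_def)
  have "(\<integral>\<^sup>+V. ennreal (f V) \<partial>count_space UNIV) = (\<integral>\<^sup>+V. ennreal (f V) \<partial>count_space (prefs A))"
    by (subst nn_integral_count_space_indicator)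
       (auto intro!: nn_integral_cong simp: f_def indicator_def)
  also have "\<dots> = (\<Sum>V\<in>prefs A. ennreal (f V))"
    using assms by (intro nn_integral_count_space_finite finite_prefs)
  also have "\<dots> = ennreal (\<Sum>V\<in>prefs A. f V)"
    using nn by (intro sum_ennreal) auto
  also have "(\<Sum>V\<in>prefs A. f V) = (\<Sum>V\<in>prefs A. \<phi> ^ KT A V W) / condorcet_Z A \<phi> W"
    unfolding sum_divide_distrib by (rule sum.cong) (auto simp: f_def)
  also have "\<dots> = 1"
    using Z by (simp add: condorcet_Z_def)
  finally have "(\<integral>\<^sup>+V. ennreal (f V) \<partial>count_space UNIV) = 1" by simp
  then show ?thesis
    unfolding condorcet_pmf_def f_def[symmetric] using nn by (intro pmf_embed_pmf) auto
qed

definition is_test :: "'s set \<Rightarrow> ('s \<Rightarrow> real) \<Rightarrow> bool" where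
  "is_test S f \<longleftrightarrow> (\<forall>P \<in> S. 0 \<le> f P \<and> f P \<le> 1)"

definition size_at :: "('p \<Rightarrow> 's pmf) \<Rightarrow> ('s \<Rightarrow> real) \<Rightarrow> 'p \<Rightarrow> real" where
  "size_at M f h0 = measure_pmf.expectation (M h0) f"

definition test_size :: "('p \<Rightarrow> 's pmf) \<Rightarrow> 'p set \<Rightarrow> ('s \<Rightarrow> real) \<Rightarrow> real" where
  "test_size M H0 f = (SUP h0 \<in> H0. size_at M f h0)"

definition test_power :: "('p \<Rightarrow> 's pmf) \<Rightarrow> ('s \<Rightarrow> real) \<Rightarrow> 'p \<Rightarrow> real" where
  "test_power M f h1 = measure_pmf.expectation (M h1) f"

definition is_UMP_test ::
  "'s set \<Rightarrow> ('p \<Rightarrow> 's pmf) \<Rightarrow> 'p set \<Rightarrow> 'p set \<Rightarrow> real \<Rightarrow> ('s \<Rightarrow> real) \<Rightarrow> bool" where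
  "is_UMP_test S M H0 H1 \<alpha> f \<longleftrightarrow>
     is_test S f \<and> test_size M H0 f = \<alpha> \<and>
     (\<forall>h1 \<in> H1. \<forall>g. is_test S g \<and> test_size M H0 g \<le> \<alpha> \<longrightarrow> test_power M f h1 \<ge> test_power M g h1)"

definition votes :: "'a rel list \<Rightarrow> 'a \<Rightarrow> 'a \<Rightarrow> nat" where
  "votes P b c = length (filter (\<lambda>V. (b, c) \<in> V) P)"

definition margin :: "'a rel list \<Rightarrow> 'a \<Rightarrow> 'a \<Rightarrow> int" where
  "margin P b c = int (votes P b c) - int (votes P c b)"

definition Ratio :: "'a set \<Rightarrow> real \<Rightarrow> 'a \<Rightarrow> 'a rel list \<Rightarrow> real" where
  "Ratio A \<phi> a P = (real (card A) - 1) / (\<Sum>b \<in> A - {a}. \<phi> powi margin P a b)"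

definition ratio_test :: "'a set \<Rightarrow> real \<Rightarrow> 'a \<Rightarrow> real \<Rightarrow> real \<Rightarrow> 'a rel list \<Rightarrow> real" where
  "ratio_test A \<phi> a K \<Gamma> P =
     (if Ratio A \<phi> a P > K then 1 else if Ratio A \<phi> a P < K then 0 else \<Gamma>)"

end

theory Submission
  imports Defs "HOL-Combinatorics.Transposition"
begin

text \<open>
  The proof replaces the composite null hypothesis by a least favourable mixture and then applies
  the Neyman--Pearson argument. Let \<open>T\<close> be a parameter in which \<open>a\<close> beats everybody, and for
  \<open>b \<noteq> a\<close> let \<open>H b\<close> be \<open>T\<close> with the single pair \<open>(a, b)\<close> reversed; this is the nearest way to
  falsify the alternative. Reversing a pair multiplies the likelihood of a profile by \<open>\<phi>\<close> to the
  power of its margin on that pair (\<open>pmf_condorcet_model_reverse_pair\<close>), so the likelihood ratio of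
  \<open>T\<close> against the uniform mixture of the \<open>H b\<close> is exactly \<open>Ratio\<close>. Among all tests with no larger
  average rejection probability over the \<open>H b\<close>, the ratio test is therefore the most powerful one
  at \<open>T\<close> (\<open>sum_size_at_le_imp_power_le\<close>).

  It remains to see that the size of the ratio test over the whole null hypothesis is attained at
  every \<open>H b\<close> (\<open>test_size_ratio_test\<close>), for then a competitor of size at most \<open>\<alpha>\<close> has no larger
  average over the \<open>H b\<close>. This rests on two facts. The ratio test increases with the margins of
  \<open>a\<close>, and the expectation of such a test does not decrease when the parameter changes in a
  way that creates no new loss for \<open>a\<close> (\<open>size_at_mono\<close>). It is moreover invariant under exchanging
  two opponents of \<open>a\<close>. Now in a parameter of the null hypothesis \<open>a\<close> loses to some \<open>c\<close>, and the
  exchange of \<open>b\<close> and \<open>c\<close> turns \<open>H b\<close> into a parameter in which this is the only loss of \<open>a\<close>.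
  Because the same \<open>H b\<close> serves for all thresholds, the threshold and the
  randomization can be calibrated at one single distribution (\<open>threshold_exists\<close>).
\<close>


section \<open>Symmetries of the set of preference relations\<close>

lemma prefsI:
  assumes "V \<subseteq> A \<times> A" "\<And>x y. (x, y) \<in> V \<Longrightarrow> (y, x) \<notin> V"
    and "\<And>x y. x \<in> A \<Longrightarrow> y \<in> A \<Longrightarrow> x \<noteq> y \<Longrightarrow> (x, y) \<in> V \<or> (y, x) \<in> V"
  shows "V \<in> prefs A"
proof -
  have "irrefl V" using assms(2) by (blast intro: irreflI)
  moreover have "antisym V" using assms(2) by (blast intro: antisymI)
  moreover have "total_on A V" using assms(3) by (blast intro: total_onI)
  ultimately show ?thesis using assms(1) by (simp add: prefs_def)
qed

lemma prefsD:
  assumes "V \<in> prefs A" "(x, y) \<in> V"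
  shows "x \<in> A" "y \<in> A" "x \<noteq> y" "(y, x) \<notin> V"
  using assms by (auto simp: prefs_def irrefl_def dest: antisymD)

lemma prefs_total:
  assumes "V \<in> prefs A" "x \<in> A" "y \<in> A" "x \<noteq> y"
  shows "(x, y) \<in> V \<or> (y, x) \<in> V"
  using assms by (auto simp: prefs_def total_on_def)

lemma prefs_swap_iff:
  assumes "V \<in> prefs A" "x \<in> A" "y \<in> A" "x \<noteq> y"
  shows "(y, x) \<in> V \<longleftrightarrow> (x, y) \<notin> V"
  using prefs_total[OF assms] prefsD(4)[OF assms(1)] by blast

text \<open>A pair on which \<open>V\<close> and \<open>W\<close> disagree has exactly one orientation that lies in \<open>V\<close>, and this
  orientation is missing from \<open>W\<close>. Counting ordered pairs makes the distance amenable to set algebra.\<close>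

lemma KT_eq_card_Diff:
  assumes V: "V \<in> prefs A" and W: "W \<in> prefs A"
  shows "KT A V W = card (V - W)"
proof -
  have "bij_betw (\<lambda>(b, c). {b, c}) (V - W)
     {{b, c} | b c. b \<in> A \<and> c \<in> A \<and> b \<noteq> c \<and> ((b, c) \<in> V) \<noteq> ((b, c) \<in> W)}"
    (is "bij_betw ?u _ ?D")
    unfolding bij_betw_def
  proof
    have asym: "\<And>x y. (x, y) \<in> V \<Longrightarrow> (y, x) \<notin> V"
      using prefsD(4)[OF V] .
    show "inj_on ?u (V - W)"
      by (auto simp: inj_on_def doubleton_eq_iff dest: asym)
    show "?u ` (V - W) = ?D"
    proof (intro equalityI subsetI)
      fix s assume "s \<in> ?u ` (V - W)"
      then obtain b c where s: "s = {b, c}" and bc: "(b, c) \<in> V" "(b, c) \<notin> W" by auto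
      have "b \<in> A" "c \<in> A" "b \<noteq> c" using prefsD[OF V bc(1)] by auto
      with s bc show "s \<in> ?D" by blast
    next
      fix s assume "s \<in> ?D"
      then obtain b c where s: "s = {b, c}" "b \<in> A" "c \<in> A" "b \<noteq> c"
        and d: "((b, c) \<in> V) \<noteq> ((b, c) \<in> W)" by auto
      have "(b, c) \<in> V - W \<or> (c, b) \<in> V - W"
        using d prefs_swap_iff[OF V s(2-4)] prefs_swap_iff[OF W s(2-4)] by blast
      moreover have "s = ?u (b, c)" "s = ?u (c, b)" using s(1) by auto
      ultimately show "s \<in> ?u ` (V - W)" by blast
    qed
  qed
  then show ?thesis
    unfolding KT_def by (rule bij_betw_same_card[symmetric])
qed

text \<open>Both the reversal of one pair and the relabelling of alternatives act on relations through a
  permutation of the ordered pairs that respects the passage from a pair to its converse. The model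
  is equivariant under all these permutations.\<close>

definition pair_symmetry :: "'a set \<Rightarrow> ('a \<times> 'a \<Rightarrow> 'a \<times> 'a) \<Rightarrow> bool" where
  "pair_symmetry A e \<longleftrightarrow> bij_betw e (A \<times> A) (A \<times> A) \<and>
     (\<forall>p \<in> A \<times> A. e (prod.swap p) = prod.swap (e p))"

lemma pair_symmetry_swap:
  assumes "pair_symmetry A e" "p \<in> A \<times> A"
  shows "e (prod.swap p) = prod.swap (e p)"
  using assms unfolding pair_symmetry_def by blast

lemma pair_symmetry_mem_image_iff:
  assumes "pair_symmetry A e" "V \<subseteq> A \<times> A" "p \<in> A \<times> A"
  shows "e p \<in> e ` V \<longleftrightarrow> p \<in> V"
  using assms unfolding pair_symmetry_def bij_betw_def by (meson inj_on_image_mem_iff)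

lemma pair_symmetry_image_prefs:
  assumes e: "pair_symmetry A e" and V: "V \<in> prefs A"
  shows "e ` V \<in> prefs A"
proof -
  have VA: "V \<subseteq> A \<times> A" using V by (simp add: prefs_def)
  have im: "e ` (A \<times> A) = A \<times> A" using e by (simp add: pair_symmetry_def bij_betw_def)
  \<comment> \<open>Asymmetry and totality of a relation in \<open>prefs A\<close> can be read off pairs of the form
    \<open>e p\<close>, because \<open>e\<close> is onto.\<close>
  have mem: "q \<in> e ` V \<longleftrightarrow> p \<in> V" "prod.swap q \<in> e ` V \<longleftrightarrow> prod.swap p \<in> V"
    if "p \<in> A \<times> A" "q = e p" for p q
  proof -
    have swap: "prod.swap q = e (prod.swap p)"
      unfolding that(2) by (rule pair_symmetry_swap[OF e that(1), symmetric])
    have "prod.swap p \<in> A \<times> A" using that(1) by auto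
    then show "q \<in> e ` V \<longleftrightarrow> p \<in> V" "prod.swap q \<in> e ` V \<longleftrightarrow> prod.swap p \<in> V"
      unfolding that(2) swap[unfolded that(2)]
      using pair_symmetry_mem_image_iff[OF e VA] that(1) by simp_all
  qed
  have sub: "e ` V \<subseteq> A \<times> A" using im VA by blast
  have asym: "(y, x) \<notin> e ` V" if "(x, y) \<in> e ` V" for x y
  proof -
    from that obtain p where p: "(x, y) = e p" "p \<in> V" by (rule imageE)
    then have "prod.swap p \<notin> V" using prefsD(4)[OF V] by (cases p) simp
    then show ?thesis using mem(2)[OF _ p(1)] p(2) VA by fastforce
  qed
  have tot: "(x, y) \<in> e ` V \<or> (y, x) \<in> e ` V" if xy: "x \<in> A" "y \<in> A" "x \<noteq> y" for x y
  proof -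
    have "(x, y) \<in> e ` (A \<times> A)" using im xy by simp
    then obtain p where p: "(x, y) = e p" "p \<in> A \<times> A" by (rule imageE)
    have "p \<noteq> prod.swap p"
      using pair_symmetry_swap[OF e p(2)] xy(3) by (metis p(1) Pair_inject swap_simp)
    then have "p \<in> V \<or> prod.swap p \<in> V"
      using prefs_total[OF V, of "fst p" "snd p"] p(2) by (cases p) auto
    then show ?thesis using mem[OF p(2,1)] by simp
  qed
  from sub asym tot show ?thesis by (rule prefsI)
qed

lemma pair_symmetry_bij_betw_prefs:
  assumes e: "pair_symmetry A e" and A: "finite A"
  shows "bij_betw (image e) (prefs A) (prefs A)"
proof -
  have inj: "inj_on (image e) (prefs A)"
    using e by (intro inj_on_subset[OF inj_on_image_Pow[of e "A \<times> A"]])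
      (auto simp: pair_symmetry_def bij_betw_def prefs_def)
  moreover have "image e ` prefs A \<subseteq> prefs A"
    using pair_symmetry_image_prefs[OF e] by blast
  ultimately show ?thesis
    unfolding bij_betw_def using finite_prefs[OF A] by (simp add: endo_inj_surj)
qed

lemma KT_image:
  assumes e: "pair_symmetry A e" and V: "V \<in> prefs A" and W: "W \<in> prefs A"
  shows "KT A (e ` V) (e ` W) = KT A V W"
proof -
  have inj: "inj_on e (A \<times> A)" and VW: "V \<subseteq> A \<times> A" "W \<subseteq> A \<times> A"
    using e V W by (auto simp: pair_symmetry_def bij_betw_def prefs_def)
  then have "e ` V - e ` W = e ` (V - W)"
    by (metis Diff_subset dual_order.trans inj_on_image_set_diff)
  moreover have "inj_on e (V - W)" using inj VW by (blast intro: inj_on_subset)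
  ultimately have "card (e ` V - e ` W) = card (V - W)" by (simp add: card_image)
  then show ?thesis
    using e V W by (simp add: KT_eq_card_Diff pair_symmetry_image_prefs)
qed

lemma condorcet_Z_image:
  assumes e: "pair_symmetry A e" and "finite A" and W: "W \<in> prefs A"
  shows "condorcet_Z A \<phi> (e ` W) = condorcet_Z A \<phi> W"
proof -
  have "(\<Sum>V\<in>prefs A. \<phi> ^ KT A V W) = (\<Sum>V\<in>prefs A. \<phi> ^ KT A (e ` V) (e ` W))"
    by (intro sum.cong refl) (simp add: KT_image[OF e] W)
  also have "\<dots> = (\<Sum>V\<in>prefs A. \<phi> ^ KT A V (e ` W))"
    by (rule sum.reindex_bij_betw) (rule pair_symmetry_bij_betw_prefs[OF e \<open>finite A\<close>])
  finally show ?thesis by (simp add: condorcet_Z_def)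
qed

lemma set_condorcet_pmf:
  assumes "finite A" "\<phi> > 0"
  shows "set_pmf (condorcet_pmf A \<phi> W) = prefs A"
  using condorcet_Z_pos[OF assms, of W] assms
  by (auto simp: set_pmf_iff pmf_condorcet split: if_splits)

lemma set_condorcet_model:
  assumes "finite A" "\<phi> > 0"
  shows "set_pmf (condorcet_model A \<phi> n W) = profiles A n"
  using assms by (auto simp: condorcet_model_def set_replicate_pmf set_condorcet_pmf profiles_def)

text \<open>The distance \<open>KT\<close> is invariant under a simultaneous action on both relations, hence so is the
  normalization factor.\<close>

lemma condorcet_pmf_image:
  assumes e: "pair_symmetry A e" and A: "finite A" "\<phi> > 0" and W: "W \<in> prefs A"
  shows "condorcet_pmf A \<phi> (e ` W) = map_pmf (image e) (condorcet_pmf A \<phi> W)"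
proof (rule pmf_eqI)
  fix V
  note bij = pair_symmetry_bij_betw_prefs[OF e A(1)]
  show "pmf (condorcet_pmf A \<phi> (e ` W)) V = pmf (map_pmf (image e) (condorcet_pmf A \<phi> W)) V"
  proof (cases "V \<in> prefs A")
    case True
    then obtain U where U: "U \<in> prefs A" "V = e ` U"
      using bij unfolding bij_betw_def by blast
    have "pmf (map_pmf (image e) (condorcet_pmf A \<phi> W)) V = pmf (condorcet_pmf A \<phi> W) U"
      using bij U A by (auto simp: bij_betw_def set_condorcet_pmf intro: pmf_map_inj)
    also have "\<dots> = pmf (condorcet_pmf A \<phi> (e ` W)) V"
      using True U A W e by (simp add: pmf_condorcet KT_image condorcet_Z_image)
    finally show ?thesis ..
  next
    case False
    then have "V \<notin> image e ` set_pmf (condorcet_pmf A \<phi> W)"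
      using pair_symmetry_image_prefs[OF e] A by (auto simp: set_condorcet_pmf)
    then show ?thesis
      using False A by (simp add: pmf_map_outside pmf_condorcet)
  qed
qed

lemma map_replicate_pmf:
  "replicate_pmf n (map_pmf h p) = map_pmf (map h) (replicate_pmf n p)"
  by (induction n) (simp_all add: map_pmf_def bind_assoc_pmf bind_return_pmf)

lemma condorcet_model_image:
  assumes "pair_symmetry A e" "finite A" "\<phi> > 0" "W \<in> prefs A"
  shows "condorcet_model A \<phi> n (e ` W) = map_pmf (map (image e)) (condorcet_model A \<phi> n W)"
  using assms by (simp add: condorcet_model_def condorcet_pmf_image map_replicate_pmf)

lemma map_image_profiles:
  assumes "pair_symmetry A e" "P \<in> profiles A n"
  shows "map (image e) P \<in> profiles A n"
  using assms by (auto simp: profiles_def intro: pair_symmetry_image_prefs)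

lemma finite_profiles: "finite A \<Longrightarrow> finite (profiles A n)"
  unfolding profiles_def
  by (rule finite_subset[OF _ finite_lists_length_eq[OF finite_prefs, where n = n]]) auto

lemma size_at_condorcet_eq_sum:
  assumes "finite A" "\<phi> > 0"
  shows "size_at (condorcet_model A \<phi> n) f W =
    (\<Sum>P\<in>profiles A n. f P * pmf (condorcet_model A \<phi> n W) P)"
  unfolding size_at_def
  by (rule integral_measure_pmf_real) (auto simp: assms finite_profiles set_condorcet_model)

lemma votes_map_image:
  assumes e: "pair_symmetry A e" and P: "P \<in> profiles A n"
    and b: "b' \<in> A" "c' \<in> A" "e (b', c') = (b, c)"
  shows "votes (map (image e) P) b c = votes P b' c'"
proof -
  have "(b, c) \<in> e ` V \<longleftrightarrow> (b', c') \<in> V" if "V \<in> set P" for V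
    using pair_symmetry_mem_image_iff[OF e, of V "(b', c')"] that P b
    by (auto simp: profiles_def prefs_def)
  then have "filter (\<lambda>V. (b, c) \<in> e ` V) P = filter (\<lambda>V. (b', c') \<in> V) P"
    by (intro filter_cong) auto
  then show ?thesis
    by (simp add: votes_def filter_map o_def)
qed

lemma margin_map_image:
  assumes e: "pair_symmetry A e" and P: "P \<in> profiles A n"
    and b: "b' \<in> A" "c' \<in> A" "e (b', c') = (b, c)"
  shows "margin (map (image e) P) b c = margin P b' c'"
proof -
  have "e (c', b') = (c, b)"
    using pair_symmetry_swap[OF e, of "(b', c')"] b by simp
  then show ?thesis
    unfolding margin_def votes_map_image[OF e P b]
    using votes_map_image[OF e P b(2,1)] by simp
qed

lemma size_at_image:
  assumes "pair_symmetry A e" "finite A" "\<phi> > 0" "W \<in> prefs A"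
  shows "size_at (condorcet_model A \<phi> n) f (e ` W) =
    size_at (condorcet_model A \<phi> n) (\<lambda>P. f (map (image e) P)) W"
  using assms by (simp add: size_at_def condorcet_model_image)


section \<open>Reversing a single pair\<close>

abbreviation reverse_pair :: "'a \<Rightarrow> 'a \<Rightarrow> 'a \<times> 'a \<Rightarrow> 'a \<times> 'a" where
  "reverse_pair x y \<equiv> Transposition.transpose (x, y) (y, x)"

lemma pair_symmetry_reverse_pair:
  assumes "x \<in> A" "y \<in> A"
  shows "pair_symmetry A (reverse_pair x y)"
  unfolding pair_symmetry_def
proof
  show "bij_betw (reverse_pair x y) (A \<times> A) (A \<times> A)"
    using assms by (simp add: bij_betw_def)
  show "\<forall>p\<in>A \<times> A. reverse_pair x y (prod.swap p) = prod.swap (reverse_pair x y p)"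
  proof
    fix p :: "'a \<times> 'a"
    consider "p = (x, y)" | "p = (y, x)" | "p \<noteq> (x, y)" "p \<noteq> (y, x)" by blast
    then show "reverse_pair x y (prod.swap p) = prod.swap (reverse_pair x y p)"
    proof cases
      case 3
      then have "prod.swap p \<noteq> (x, y)" "prod.swap p \<noteq> (y, x)"
        by (auto simp: prod.swap_def prod_eq_iff)
      with 3 show ?thesis by simp
    qed simp_all
  qed
qed

lemma reverse_pair_image:
  assumes "(x, y) \<in> V" "(y, x) \<notin> V"
  shows "reverse_pair x y ` V = insert (y, x) (V - {(x, y)})"
  using assms by (auto simp: in_transpose_image_iff Transposition.transpose_def split: if_splits)

lemma reverse_pair_image_image: "reverse_pair x y ` reverse_pair x y ` V = V"
  by (simp add: image_comp)

lemma pmf_condorcet_reverse_pair: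
  assumes A: "finite A" "\<phi> > 0" and W: "W \<in> prefs A" "(x, y) \<in> W" and V: "V \<in> prefs A"
  shows "pmf (condorcet_pmf A \<phi> (reverse_pair x y ` W)) V =
    pmf (condorcet_pmf A \<phi> W) V * (if (x, y) \<in> V then \<phi> else inverse \<phi>)"
proof -
  have xy: "x \<in> A" "y \<in> A" "x \<noteq> y" "(y, x) \<notin> W"
    using prefsD[OF W] by blast+
  let ?W = "reverse_pair x y ` W"
  note e = pair_symmetry_reverse_pair[OF xy(1,2)]
  have W': "?W \<in> prefs A" using pair_symmetry_image_prefs[OF e W(1)] .
  have W'_eq: "?W = insert (y, x) (W - {(x, y)})"
    using reverse_pair_image W(2) xy(4) by metis
  have finV: "finite V" using V finite_subset[of V "A \<times> A"] A(1) by (simp add: prefs_def)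
  show ?thesis
  proof (cases "(x, y) \<in> V")
    case True
    then have "(y, x) \<notin> V" using prefs_swap_iff[OF V xy(1-3)] by blast
    then have "V - ?W = insert (x, y) (V - W)" using True W'_eq xy(3) by auto
    then have "card (V - ?W) = Suc (card (V - W))" using finV W(2) by simp
    then show ?thesis
      using True V W W' A by (simp add: pmf_condorcet KT_eq_card_Diff condorcet_Z_image[OF e])
  next
    case False
    then have yx: "(y, x) \<in> V" using prefs_swap_iff[OF V xy(1-3)] by blast
    then have "V - W = insert (y, x) (V - ?W)" using False W'_eq xy by auto
    moreover have "(y, x) \<notin> V - ?W" using W'_eq by simp
    moreover have "finite (V - ?W)" using finV by simp
    ultimately have "card (V - W) = Suc (card (V - ?W))" by simp
    then show ?thesis
      using False V W W' A by (simp add: pmf_condorcet KT_eq_card_Diff condorcet_Z_image[OF e])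
  qed
qed

lemma pmf_replicate_pmf_Cons:
  "pmf (replicate_pmf (Suc n) p) (x # xs) = pmf p x * pmf (replicate_pmf n p) xs"
proof -
  have "replicate_pmf (Suc n) p = map_pmf (\<lambda>(x, xs). x # xs) (pair_pmf p (replicate_pmf n p))"
    by (simp add: pair_pmf_def map_pmf_def bind_assoc_pmf bind_return_pmf)
  moreover have "inj (\<lambda>(x, xs). x # xs)" by (auto simp: inj_def)
  ultimately show ?thesis
    using pmf_map_inj'[of "\<lambda>(x, xs). x # xs" "pair_pmf p (replicate_pmf n p)" "(x, xs)"]
    by (simp add: pmf_pair del: replicate_pmf.simps)
qed

text \<open>Votes containing \<open>(x, y)\<close> move one step away from the parameter and the others move one step
  closer, so over a profile the powers of \<open>\<phi>\<close> accumulate to the margin.\<close>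

lemma pmf_condorcet_model_reverse_pair:
  assumes A: "finite A" "\<phi> > 0" and W: "W \<in> prefs A" "(x, y) \<in> W" and P: "P \<in> profiles A n"
  shows "pmf (condorcet_model A \<phi> n (reverse_pair x y ` W)) P =
    pmf (condorcet_model A \<phi> n W) P * \<phi> powi margin P x y"
  using P
proof (induction n arbitrary: P)
  case 0
  then show ?case by (simp add: profiles_def condorcet_model_def margin_def votes_def)
next
  case (Suc n)
  then obtain V Q where P: "P = V # Q" "V \<in> prefs A" "Q \<in> profiles A n"
    by (cases P) (auto simp: profiles_def)
  have xy: "x \<in> A" "y \<in> A" "x \<noteq> y"
    using prefsD[OF W] by blast+
  have "margin P x y = (if (x, y) \<in> V then 1 else -1) + margin Q x y"
    using prefs_swap_iff[OF P(2) xy] by (simp add: P(1) margin_def votes_def)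
  then have "\<phi> powi margin P x y = (if (x, y) \<in> V then \<phi> else inverse \<phi>) * \<phi> powi margin Q x y"
    using A(2) by (simp add: power_int_add)
  then show ?case
    using Suc.IH[OF P(3)] pmf_condorcet_reverse_pair[OF A W P(2)]
    by (simp add: P(1) condorcet_model_def pmf_replicate_pmf_Cons del: replicate_pmf.simps)
qed


section \<open>Tests that increase with the margins of an alternative\<close>

text \<open>Since equal margins force equal values, such a test depends on the profile only through the margins
  of \<open>a\<close>.\<close>

definition margin_mono :: "'a set \<Rightarrow> nat \<Rightarrow> 'a \<Rightarrow> ('a rel list \<Rightarrow> real) \<Rightarrow> bool" where
  "margin_mono A n a f \<longleftrightarrow> (\<forall>P \<in> profiles A n. \<forall>Q \<in> profiles A n.
     (\<forall>b \<in> A - {a}. margin P a b \<le> margin Q a b) \<longrightarrow> f P \<le> f Q)"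

lemma margin_swap: "margin P b c = - margin P c b"
  by (simp add: margin_def)

text \<open>Let \<open>s\<close> reverse the pair \<open>{x, y}\<close> in every vote. It exchanges the distributions under the old and
  the new parameter, so twice the gain in expectation is the sum over \<open>P\<close> of \<open>f P - f (s P)\<close> times
  the difference of the likelihoods of \<open>P\<close>. Each summand is nonnegative: if \<open>x = a\<close>, the
  margin of \<open>a\<close> over \<open>y\<close> decides the direction of both differences, and if neither \<open>x\<close> nor \<open>y\<close> is \<open>a\<close>, the first factor
  vanishes because \<open>s\<close> preserves the margins of \<open>a\<close>.\<close>

lemma size_at_le_reverse_pair:
  assumes A: "finite A" "0 < \<phi>" "\<phi> < 1" and f: "margin_mono A n a f"
    and W: "W \<in> prefs A" "(y, x) \<in> W" and a: "a \<in> A" "y \<noteq> a"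
  shows "size_at (condorcet_model A \<phi> n) f W \<le>
    size_at (condorcet_model A \<phi> n) f (reverse_pair y x ` W)"
proof -
  let ?M = "condorcet_model A \<phi> n" and ?r = "reverse_pair y x"
  let ?W = "?r ` W" and ?s = "map (image ?r)"
  have xy: "x \<in> A" "y \<in> A" "x \<noteq> y" using prefsD[OF W] by blast+
  note e = pair_symmetry_reverse_pair[OF xy(2,1)]
  have W': "?W \<in> prefs A" using pair_symmetry_image_prefs[OF e W(1)] .
  have flipped: "size_at ?M f ?W = size_at ?M (\<lambda>P. f (?s P)) W"
    by (rule size_at_image[OF e A(1,2) W(1)])
  have unflipped: "size_at ?M f W = size_at ?M (\<lambda>P. f (?s P)) ?W"
    using size_at_image[OF e A(1,2) W', of n f] by (simp add: reverse_pair_image_image)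
  have pos: "0 \<le> (f P - f (?s P)) * (pmf (?M ?W) P - pmf (?M W) P)"
    if P: "P \<in> profiles A n" for P
  proof -
    have sP: "?s P \<in> profiles A n" using map_image_profiles[OF e P] .
    have pmf_W': "pmf (?M ?W) P = pmf (?M W) P * \<phi> powi margin P y x"
      by (rule pmf_condorcet_model_reverse_pair[OF A(1,2) W P])
    have mar: "margin (?s P) a b = (if (a, b) = (x, y) then - margin P a b else margin P a b)"
      if b: "b \<in> A - {a}" for b
    proof (cases "(a, b) = (x, y)")
      case True
      then have "margin (?s P) x y = margin P y x"
        using xy by (intro margin_map_image[OF e P]) simp_all
      then show ?thesis using True margin_swap[of P y x] by simp
    next
      case False
      then have "?r (a, b) = (a, b)" using a(2) by (intro transpose_apply_other) auto
      then have "margin (?s P) a b = margin P a b"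
        using a(1) b by (intro margin_map_image[OF e P]) simp_all
      with False show ?thesis by (simp only: if_False)
    qed
    have le: "f P \<le> f (?s P)" if "x = a \<Longrightarrow> margin P x y \<le> 0"
    proof -
      have "margin P a b \<le> margin (?s P) a b" if "b \<in> A - {a}" for b
        unfolding mar[OF that] using \<open>x = a \<Longrightarrow> _\<close> by (cases "(a, b) = (x, y)") auto
      then show ?thesis using f P sP unfolding margin_mono_def by blast
    qed
    have ge: "f (?s P) \<le> f P" if "x = a \<Longrightarrow> 0 \<le> margin P x y"
    proof -
      have "margin (?s P) a b \<le> margin P a b" if "b \<in> A - {a}" for b
        unfolding mar[OF that] using \<open>x = a \<Longrightarrow> _\<close> by (cases "(a, b) = (x, y)") auto
      then show ?thesis using f P sP unfolding margin_mono_def by blast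
    qed
    show ?thesis
    proof (cases "0 \<le> margin P x y")
      case True
      then have "f (?s P) \<le> f P" by (intro ge)
      moreover have "pmf (?M W) P \<le> pmf (?M ?W) P"
        using pmf_W' True A margin_swap[of P y x] power_int_decreasing[of "margin P y x" 0 \<phi>]
        by (simp add: mult_le_cancel_left1 mult_le_cancel_left2 mult_left_le)
      ultimately show ?thesis by (simp add: mult_nonneg_nonneg)
    next
      case False
      then have "f P \<le> f (?s P)" by (intro le) simp
      moreover have "pmf (?M ?W) P \<le> pmf (?M W) P"
        using pmf_W' False A margin_swap[of P y x] power_int_decreasing[of 0 "margin P y x" \<phi>]
        by (simp add: mult_le_cancel_left1 mult_le_cancel_left2 mult_left_le)
      ultimately show ?thesis by (simp add: mult_nonpos_nonpos)
    qed
  qed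
  have "0 \<le> (\<Sum>P\<in>profiles A n. (f P - f (?s P)) * (pmf (?M ?W) P - pmf (?M W) P))"
    by (intro sum_nonneg pos)
  also have "\<dots> = size_at ?M f ?W - size_at ?M (\<lambda>P. f (?s P)) ?W
      - (size_at ?M f W - size_at ?M (\<lambda>P. f (?s P)) W)"
    by (simp add: size_at_condorcet_eq_sum[OF A(1,2)] sum_subtractf[symmetric] algebra_simps)
  also have "\<dots> = 2 * (size_at ?M f ?W - size_at ?M f W)"
    using flipped unflipped by simp
  finally show ?thesis by simp
qed

text \<open>Only the pairs lost by \<open>a\<close> matter: turning \<open>W\<close> into \<open>T\<close> one disagreement at a time, every
  step either concerns a pair without \<open>a\<close> or lets \<open>a\<close> win, since \<open>T\<close> contains no new loss of
  \<open>a\<close>.\<close>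

lemma size_at_mono:
  assumes A: "finite A" "0 < \<phi>" "\<phi> < 1" and f: "margin_mono A n a f" and a: "a \<in> A"
    and W: "W \<in> prefs A" and T: "T \<in> prefs A" and losses: "\<And>x. (x, a) \<in> T \<Longrightarrow> (x, a) \<in> W"
  shows "size_at (condorcet_model A \<phi> n) f W \<le> size_at (condorcet_model A \<phi> n) f T"
  using W losses
proof (induction "card (T - W)" arbitrary: W)
  case 0
  have fin: "finite T" using T finite_subset[of T "A \<times> A"] A(1) by (simp add: prefs_def)
  then have sub: "T \<subseteq> W" using 0 by simp
  have "W \<subseteq> T"
  proof (rule subrelI)
    fix x y assume xy: "(x, y) \<in> W"
    note D = prefsD[OF 0(2) xy]
    then have "(y, x) \<notin> T" using sub by blast
    then show "(x, y) \<in> T" using prefs_swap_iff[OF T D(1-3)] by blast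
  qed
  with sub have "W = T" by blast
  then show ?case by simp
next
  case (Suc k)
  then have "T - W \<noteq> {}" by (metis card.empty nat.distinct(1))
  then obtain x y where xy: "(x, y) \<in> T" "(x, y) \<notin> W" by auto
  note D = prefsD[OF T xy(1)]
  let ?W = "reverse_pair y x ` W"
  have yx: "(y, x) \<in> W" using prefs_swap_iff[OF Suc.prems(1) D(1-3)] xy by blast
  have "y \<noteq> a" using Suc.prems(2) xy by blast
  then have "size_at (condorcet_model A \<phi> n) f W \<le> size_at (condorcet_model A \<phi> n) f ?W"
    by (rule size_at_le_reverse_pair[OF A f Suc.prems(1) yx a])
  also have "size_at (condorcet_model A \<phi> n) f ?W \<le> size_at (condorcet_model A \<phi> n) f T"
  proof (rule Suc.hyps(1))
    have W': "?W = insert (x, y) (W - {(y, x)})" using reverse_pair_image[OF yx xy(2)] .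
    then have "T - ?W = T - W - {(x, y)}" using D(4) by blast
    then show "k = card (T - ?W)" using Suc.hyps(2) xy by simp
    show "?W \<in> prefs A"
      using pair_symmetry_image_prefs[OF pair_symmetry_reverse_pair Suc.prems(1)] D by blast
    show "(z, a) \<in> ?W" if "(z, a) \<in> T" for z
      using Suc.prems(2)[OF that] that W' D(4) by blast
  qed
  finally show ?case .
qed

lemma opponents_nonempty:
  assumes "card A \<ge> 2"
  shows "A - {a} \<noteq> {}"
proof
  assume "A - {a} = {}"
  then have "card A \<le> card {a}" by (intro card_mono) auto
  with assms show False by simp
qed

lemma Ratio_mono:
  assumes A: "finite A" "card A \<ge> 2" "0 < \<phi>" "\<phi> < 1"
    and le: "\<And>b. b \<in> A - {a} \<Longrightarrow> margin P a b \<le> margin Q a b"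
  shows "Ratio A \<phi> a P \<le> Ratio A \<phi> a Q"
proof -
  have "A - {a} \<noteq> {}" using A(2) by (rule opponents_nonempty)
  then have pos: "0 < (\<Sum>b\<in>A - {a}. \<phi> powi margin Q a b)"
    using A by (intro sum_pos) auto
  have "(\<Sum>b\<in>A - {a}. \<phi> powi margin Q a b) \<le> (\<Sum>b\<in>A - {a}. \<phi> powi margin P a b)"
    using A le by (intro sum_mono power_int_decreasing) auto
  then show ?thesis
    unfolding Ratio_def using A(2) pos by (intro divide_left_mono) auto
qed

lemma margin_mono_ratio_test:
  assumes "finite A" "card A \<ge> 2" "0 < \<phi>" "\<phi> < 1" "\<Gamma> \<in> {0..1}"
  shows "margin_mono A n a (ratio_test A \<phi> a K \<Gamma>)"
  unfolding margin_mono_def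
proof (intro ballI impI)
  fix P Q assume "\<forall>b\<in>A - {a}. margin P a b \<le> margin Q a b"
  then have "Ratio A \<phi> a P \<le> Ratio A \<phi> a Q"
    using assms by (intro Ratio_mono) auto
  then show "ratio_test A \<phi> a K \<Gamma> P \<le> ratio_test A \<phi> a K \<Gamma> Q"
    using assms(5) by (auto simp: ratio_test_def)
qed


section \<open>The least favourable parameters\<close>

lemma prefs_top_nonempty:
  assumes a: "a \<in> A"
  obtains T where "T \<in> prefs_top A a"
proof -
  obtain V where V: "V \<in> prefs A" using prefs_nonempty by blast
  let ?T = "{p \<in> V. fst p \<noteq> a \<and> snd p \<noteq> a} \<union> {a} \<times> (A - {a})"
  have "?T \<in> prefs A"
  proof (rule prefsI)
    show "?T \<subseteq> A \<times> A" using V a by (auto simp: prefs_def)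
    show "(y, x) \<notin> ?T" if "(x, y) \<in> ?T" for x y
      using that prefsD(4)[OF V, of x y] by auto
    show "(x, y) \<in> ?T \<or> (y, x) \<in> ?T" if "x \<in> A" "y \<in> A" "x \<noteq> y" for x y
      using that prefs_swap_iff[OF V that] by auto
  qed
  then have "?T \<in> prefs_top A a" by (auto simp: prefs_top_def)
  then show thesis by (rule that)
qed

lemma pair_symmetry_relabel:
  assumes "b \<in> A" "c \<in> A"
  shows "pair_symmetry A (map_prod (Transposition.transpose b c) (Transposition.transpose b c))"
  unfolding pair_symmetry_def
proof
  have "bij_betw (Transposition.transpose b c) A A" using assms by simp
  then show "bij_betw (map_prod (Transposition.transpose b c) (Transposition.transpose b c)) (A \<times> A) (A \<times> A)"
    by (intro bij_betw_map_prod)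
qed auto

text \<open>Exchanging two opponents of \<open>a\<close> permutes the summands of the denominator.\<close>

lemma Ratio_relabel:
  assumes P: "P \<in> profiles A n" and a: "a \<in> A" and bc: "b \<in> A - {a}" "c \<in> A - {a}"
  shows "Ratio A \<phi> a
      (map (image (map_prod (Transposition.transpose b c) (Transposition.transpose b c))) P) =
    Ratio A \<phi> a P"
proof -
  let ?t = "Transposition.transpose b c"
  let ?P = "map (image (map_prod ?t ?t)) P"
  have e: "pair_symmetry A (map_prod ?t ?t)" using bc by (intro pair_symmetry_relabel) auto
  have ta: "?t a = a" using bc by (intro transpose_apply_other) auto
  have t: "bij_betw ?t (A - {a}) (A - {a})" using bc by simp
  have "(\<Sum>d\<in>A - {a}. \<phi> powi margin P a d) = (\<Sum>d\<in>A - {a}. \<phi> powi margin ?P a (?t d))"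
  proof (rule sum.cong[OF refl])
    fix d assume "d \<in> A - {a}"
    then have "margin ?P a (?t d) = margin P a d"
      using a ta by (intro margin_map_image[OF e P]) auto
    then show "\<phi> powi margin P a d = \<phi> powi margin ?P a (?t d)" by simp
  qed
  also have "\<dots> = (\<Sum>d\<in>A - {a}. \<phi> powi margin ?P a d)"
    by (rule sum.reindex_bij_betw[OF t])
  finally show ?thesis by (simp add: Ratio_def)
qed

text \<open>Suppose that \<open>a\<close> loses to \<open>c\<close> in \<open>W\<close>. Exchanging \<open>b\<close> and \<open>c\<close> in the parameter on the right leaves
  the expectation unchanged and makes the loss to \<open>c\<close> the only one of \<open>a\<close>, so that \<open>W\<close> is
  dominated by monotonicity. The relabelled parameter may differ from \<open>W\<close> arbitrarily on pairs
  without \<open>a\<close>.\<close>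

lemma test_size_ratio_test:
  assumes A: "finite A" "card A \<ge> 2" "0 < \<phi>" "\<phi> < 1" and a: "a \<in> A" and \<Gamma>: "\<Gamma> \<in> {0..1}"
    and T: "T \<in> prefs_top A a" and b: "b \<in> A - {a}"
  shows "test_size (condorcet_model A \<phi> n) (prefs A - prefs_top A a) (ratio_test A \<phi> a K \<Gamma>) =
    size_at (condorcet_model A \<phi> n) (ratio_test A \<phi> a K \<Gamma>) (reverse_pair a b ` T)"
proof -
  let ?f = "ratio_test A \<phi> a K \<Gamma>" and ?M = "condorcet_model A \<phi> n"
  let ?T = "reverse_pair a b ` T"
  have T': "T \<in> prefs A" "\<And>d. d \<in> A - {a} \<Longrightarrow> (a, d) \<in> T" using T by (auto simp: prefs_top_def)
  have ab: "(a, b) \<in> T" using T' b by blast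
  have T_eq: "?T = insert (b, a) (T - {(a, b)})"
    by (rule reverse_pair_image[OF ab]) (rule prefsD(4)[OF T'(1) ab])
  have T_prefs: "?T \<in> prefs A"
    using pair_symmetry_image_prefs[OF pair_symmetry_reverse_pair T'(1)] a b by blast
  have loss: "x = b" if "(x, a) \<in> ?T" for x
  proof (rule ccontr)
    assume "x \<noteq> b"
    then have xa: "(x, a) \<in> T" using that T_eq by blast
    show False using prefsD[OF T'(1) xa] T'(2)[of x] by blast
  qed
  have le: "size_at ?M ?f W \<le> size_at ?M ?f ?T" if "W \<in> prefs A - prefs_top A a" for W
  proof -
    from that obtain c where c: "c \<in> A - {a}" "(a, c) \<notin> W" and W: "W \<in> prefs A"
      by (auto simp: prefs_top_def)
    then have ca: "(c, a) \<in> W" using prefs_swap_iff[OF W a, of c] by blast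
    let ?e = "map_prod (Transposition.transpose b c) (Transposition.transpose b c)"
    have e: "pair_symmetry A ?e" using b c by (intro pair_symmetry_relabel) auto
    have "(x, a) \<in> W" if "(x, a) \<in> ?e ` ?T" for x
    proof -
      from that obtain p where p: "(x, a) = ?e p" "p \<in> ?T" by (rule imageE)
      obtain y z where pyz: "p = (y, z)" by (rule prod.exhaust)
      have yz: "(y, z) \<in> ?T" "x = Transposition.transpose b c y"
          "a = Transposition.transpose b c z"
        using p unfolding pyz by (simp_all only: map_prod_simp prod.inject)
      have "z = a" using yz(3) b c by (metis DiffD2 insertI1 transpose_involutory transpose_apply_other)
      then have "y = b" using yz(1) loss by blast
      then show ?thesis using yz(2) ca by simp
    qed
    then have "size_at ?M ?f W \<le> size_at ?M ?f (?e ` ?T)"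
      by (rule size_at_mono[OF A(1,3,4) margin_mono_ratio_test[OF A \<Gamma>] a W
        pair_symmetry_image_prefs[OF e T_prefs]])
    also have "\<dots> = size_at ?M (\<lambda>P. ?f (map (image ?e) P)) ?T"
      by (rule size_at_image[OF e A(1,3) T_prefs])
    also have "\<dots> = size_at ?M ?f ?T"
      unfolding size_at_condorcet_eq_sum[OF A(1,3)] ratio_test_def
      by (intro sum.cong refl) (simp only: Ratio_relabel[OF _ a b c(1)])
    finally show ?thesis .
  qed
  have "(a, b) \<notin> ?T" using T_eq b by auto
  then have "?T \<in> prefs A - prefs_top A a" using T_prefs b by (auto simp: prefs_top_def)
  then show ?thesis
    unfolding test_size_def using le by (intro cSup_eq_maximum) auto
qed


section \<open>Neyman--Pearson tests against a mixture\<close>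

text \<open>The Neyman--Pearson argument with the sum of the distributions \<open>M (H i)\<close> in place of a simple null
  hypothesis: by the choice of \<open>f\<close>, the factors \<open>f P - g P\<close> and \<open>pmf (M h) P - K * (\<Sum>i\<in>I. pmf (M (H i)) P)\<close>
  never have opposite signs, and it remains to sum their product over \<open>S\<close>. The factor \<open>K\<close> absorbs
  the normalization of the mixture.\<close>

lemma sum_size_at_le_imp_power_le:
  assumes S: "finite S" "\<And>i. set_pmf (M i) \<subseteq> S" and K: "0 \<le> K"
    and f: "is_test S f" and g: "is_test S g"
    and rej: "\<And>P. P \<in> S \<Longrightarrow> pmf (M h) P > K * (\<Sum>i\<in>I. pmf (M (H i)) P) \<Longrightarrow> f P = 1"
    and acc: "\<And>P. P \<in> S \<Longrightarrow> pmf (M h) P < K * (\<Sum>i\<in>I. pmf (M (H i)) P) \<Longrightarrow> f P = 0"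
    and le: "(\<Sum>i\<in>I. size_at M g (H i)) \<le> (\<Sum>i\<in>I. size_at M f (H i))"
  shows "test_power M g h \<le> test_power M f h"
proof -
  have E: "size_at M u i = (\<Sum>P\<in>S. u P * pmf (M i) P)" for u i
    unfolding size_at_def using S(2) by (intro integral_measure_pmf_real S(1)) auto
  have E_I: "(\<Sum>i\<in>I. size_at M u (H i)) = (\<Sum>P\<in>S. u P * (\<Sum>i\<in>I. pmf (M (H i)) P))" for u
    by (subst sum_distrib_left, subst sum.swap) (simp add: E)
  have "0 \<le> (\<Sum>P\<in>S. (f P - g P) * (pmf (M h) P - K * (\<Sum>i\<in>I. pmf (M (H i)) P)))"
  proof (rule sum_nonneg)
    fix P assume P: "P \<in> S"
    let ?d = "pmf (M h) P - K * (\<Sum>i\<in>I. pmf (M (H i)) P)"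
    have "0 \<le> g P" "g P \<le> 1" using g P by (auto simp: is_test_def)
    then show "0 \<le> (f P - g P) * ?d"
      using rej[OF P] acc[OF P]
      by (cases ?d "0 :: real" rule: linorder_cases) (auto intro: mult_nonpos_nonpos mult_nonneg_nonpos)
  qed
  also have "\<dots> = size_at M f h - size_at M g h
      - K * ((\<Sum>i\<in>I. size_at M f (H i)) - (\<Sum>i\<in>I. size_at M g (H i)))"
    unfolding E_I by (simp add: E algebra_simps sum_subtractf sum.distrib sum_distrib_left)
  finally have "K * ((\<Sum>i\<in>I. size_at M f (H i)) - (\<Sum>i\<in>I. size_at M g (H i))) \<le> size_at M f h - size_at M g h"
    by simp
  moreover have "0 \<le> K * ((\<Sum>i\<in>I. size_at M f (H i)) - (\<Sum>i\<in>I. size_at M g (H i)))"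
    using K le by simp
  ultimately show ?thesis by (simp add: test_power_def size_at_def)
qed

text \<open>Randomization at an atom of \<open>R\<close> interpolates between rejecting for \<open>R P > K\<close> and rejecting for
  \<open>R P \<ge> K\<close>, which makes every level attainable.\<close>

lemma threshold_exists:
  fixes p :: "'s pmf" and R :: "'s \<Rightarrow> real" and \<alpha> :: real
  assumes S: "finite (set_pmf p)" and \<alpha>: "0 < \<alpha>" "\<alpha> < 1"
  obtains K \<Gamma> where "\<Gamma> \<in> {0..1}"
    "measure_pmf.expectation p (\<lambda>P. if R P > K then 1 else if R P < K then 0 else \<Gamma>) = \<alpha>"
proof -
  define above where "above K = measure_pmf.prob p {P. R P > K}" for K
  define mass where "mass K = measure_pmf.prob p {P. R P = K}" for K
  let ?V = "R ` set_pmf p"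
  let ?G = "{K \<in> ?V. above K \<le> \<alpha>}"
  have V: "finite ?V" "?V \<noteq> {}" using S by (auto simp: set_pmf_not_empty)
  have "above (Max ?V) = 0"
    unfolding above_def measure_pmf_zero_iff using Max_ge[OF V(1)] by (fastforce simp: not_less)
  then have "Max ?V \<in> ?G" using Max_in[OF V] \<alpha> by simp
  then have G: "finite ?G" "?G \<noteq> {}" using V(1) finite_subset[of ?G ?V] by blast+
  \<comment> \<open>\<open>K\<close> is the least attained value that is exceeded with probability at most \<open>\<alpha>\<close>; the
    probability of reaching \<open>K\<close> is that of exceeding the next smaller value, hence more than \<open>\<alpha>\<close>, or 1 if there is none.\<close>
  define K where "K = Min ?G"
  have K: "K \<in> ?V" "above K \<le> \<alpha>" using Min_in[OF G] by (auto simp: K_def)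
  have split: "measure_pmf.prob p {P. R P \<ge> K} = above K + mass K"
    unfolding above_def mass_def
    by (subst measure_pmf.finite_measure_Union[symmetric]) (auto intro!: arg_cong[where f = "measure _"])
  have "\<alpha> \<le> above K + mass K"
  proof (cases "\<exists>v\<in>?V. v < K")
    case True
    let ?L = "{v \<in> ?V. v < K}"
    define L where "L = Max ?L"
    have L: "L \<in> ?V" "L < K" "\<And>v. v \<in> ?V \<Longrightarrow> v < K \<Longrightarrow> v \<le> L"
      using Max_in[of ?L] True V by (auto simp: L_def)
    have "\<not> above L \<le> \<alpha>"
      using L(1,2) Min_le[OF G(1), of L] by (auto simp: K_def)
    moreover have "above L = measure_pmf.prob p {P. R P \<ge> K}"
      unfolding above_def using L
      by (intro measure_pmf.finite_measure_eq_AE) (force simp: AE_measure_pmf_iff not_le)+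
    ultimately show ?thesis using split by simp
  next
    case False
    then have "measure_pmf.prob p {P. R P \<ge> K} = 1"
      by (intro measure_pmf.prob_eq_1[THEN iffD2]) (auto simp: AE_measure_pmf_iff not_less)
    then show ?thesis using split \<alpha> by simp
  qed
  define \<Gamma> where "\<Gamma> = (\<alpha> - above K) / mass K"
  have mass: "mass K > 0"
    using K(1) by (auto simp: mass_def measure_pmf_posI)
  have \<Gamma>: "\<Gamma> \<in> {0..1}"
    using mass K(2) \<open>\<alpha> \<le> above K + mass K\<close> by (auto simp: \<Gamma>_def field_simps)
  have "measure_pmf.expectation p (\<lambda>P. if R P > K then 1 else if R P < K then 0 else \<Gamma>) =
      measure_pmf.expectation p (\<lambda>P. indicator {P. R P > K} P + \<Gamma> * indicator {P. R P = K} P)"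
    by (intro Bochner_Integration.integral_cong) (auto simp: indicator_def)
  also have "\<dots> = above K + \<Gamma> * mass K"
    by (simp add: above_def mass_def integrable_measure_pmf_finite[OF S])
  also have "\<dots> = \<alpha>" using mass by (simp add: \<Gamma>_def)
  finally show ?thesis using that \<Gamma> by blast
qed


section \<open>The ratio test is uniformly most powerful\<close>

lemma ratio_test_most_powerful:
  assumes A: "finite A" "card A \<ge> 2" "0 < \<phi>" "\<phi> < 1" and a: "a \<in> A" and \<Gamma>: "\<Gamma> \<in> {0..1}"
    and T: "T \<in> prefs_top A a" and g: "is_test (profiles A n) g"
    and size: "test_size (condorcet_model A \<phi> n) (prefs A - prefs_top A a) (ratio_test A \<phi> a K \<Gamma>) = \<alpha>"
      "test_size (condorcet_model A \<phi> n) (prefs A - prefs_top A a) g \<le> \<alpha>"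
    and \<alpha>: "\<alpha> < 1"
  shows "test_power (condorcet_model A \<phi> n) g T \<le>
    test_power (condorcet_model A \<phi> n) (ratio_test A \<phi> a K \<Gamma>) T"
proof -
  let ?M = "condorcet_model A \<phi> n" and ?f = "ratio_test A \<phi> a K \<Gamma>"
  let ?B = "A - {a}"
  define H where "H b = reverse_pair a b ` T" for b
  have T': "T \<in> prefs A" "\<And>d. d \<in> ?B \<Longrightarrow> (a, d) \<in> T" using T by (auto simp: prefs_top_def)
  have cardB: "real (card ?B) = real (card A) - 1" "card ?B > 0" using A a by auto
  then have B: "finite ?B" "?B \<noteq> {}" using A by (auto simp: card_gt_0_iff)
  have H0: "H b \<in> prefs A - prefs_top A a" if b: "b \<in> ?B" for b
  proof -
    have "H b = insert (b, a) (T - {(a, b)})"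
      unfolding H_def using T' b prefsD(4)[OF T'(1), of a b] by (intro reverse_pair_image) auto
    moreover have "H b \<in> prefs A"
      unfolding H_def using a b
      by (intro pair_symmetry_image_prefs[OF pair_symmetry_reverse_pair T'(1)]) auto
    ultimately show ?thesis using b by (auto simp: prefs_top_def)
  qed
  have pmf_H: "pmf (?M (H b)) P = pmf (?M T) P * \<phi> powi margin P a b"
    if "b \<in> ?B" "P \<in> profiles A n" for b P
    unfolding H_def using A T' that by (intro pmf_condorcet_model_reverse_pair) auto
  \<comment> \<open>\<open>Ratio\<close> is the likelihood ratio of \<open>T\<close> against the uniform mixture of the \<open>H b\<close>.\<close>
  have mix: "(\<Sum>b\<in>?B. pmf (?M (H b)) P) = pmf (?M T) P * real (card ?B) / Ratio A \<phi> a P"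
      and Ratio_pos: "Ratio A \<phi> a P > 0"
    if P: "P \<in> profiles A n" for P
  proof -
    have pos: "(\<Sum>b\<in>?B. \<phi> powi margin P a b) > 0" using A B by (intro sum_pos) auto
    then show "Ratio A \<phi> a P > 0" using cardB unfolding Ratio_def by simp
    have "(\<Sum>b\<in>?B. pmf (?M (H b)) P) = pmf (?M T) P * (\<Sum>b\<in>?B. \<phi> powi margin P a b)"
      using P by (simp add: pmf_H sum_distrib_left)
    also have "(\<Sum>b\<in>?B. \<phi> powi margin P a b) = real (card ?B) / Ratio A \<phi> a P"
      using pos cardB by (simp add: Ratio_def)
    finally show "(\<Sum>b\<in>?B. pmf (?M (H b)) P) = pmf (?M T) P * real (card ?B) / Ratio A \<phi> a P"
      by simp
  qed
  have set_M: "set_pmf (?M W) = profiles A n" for W using A by (simp add: set_condorcet_model)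
  have f_size: "size_at ?M ?f (H b) = \<alpha>" if "b \<in> ?B" for b
    using test_size_ratio_test[OF A a \<Gamma> T that, of n K] size(1) by (simp add: H_def)
  \<comment> \<open>With a negative threshold the test would always reject and have size 1.\<close>
  have K: "0 \<le> K"
  proof (rule ccontr)
    assume "\<not> 0 \<le> K"
    then have "?f P = 1" if "P \<in> profiles A n" for P
      using Ratio_pos[OF that] by (simp add: ratio_test_def)
    then have "size_at ?M ?f W = 1" for W
      using sum_pmf_eq_1[of "profiles A n" "?M W"] A
      by (simp add: size_at_condorcet_eq_sum set_M finite_profiles)
    then show False using f_size B \<alpha> by fastforce
  qed
  have g_size: "size_at ?M g (H b) \<le> \<alpha>" if "b \<in> ?B" for b
  proof -
    have "finite (prefs A - prefs_top A a)" using A by (simp add: finite_prefs)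
    then have "size_at ?M g (H b) \<le> test_size ?M (prefs A - prefs_top A a) g"
      unfolding test_size_def by (intro cSUP_upper H0[OF that] bdd_above_finite finite_imageI)
    then show ?thesis using size(2) by simp
  qed
  show ?thesis
  proof (rule sum_size_at_le_imp_power_le[where S = "profiles A n" and I = ?B and H = H
        and K = "K / real (card ?B)"])
    have cmp: "K / real (card ?B) * (\<Sum>b\<in>?B. pmf (?M (H b)) P) = pmf (?M T) P * (K / Ratio A \<phi> a P)"
      if "P \<in> profiles A n" for P
      using mix[OF that] cardB(2) by simp
    have pos: "pmf (?M T) P > 0" if "P \<in> profiles A n" for P
      using that set_M by (simp add: pmf_positive)
    show "?f P = 1" if P: "P \<in> profiles A n"
      "pmf (?M T) P > K / real (card ?B) * (\<Sum>b\<in>?B. pmf (?M (H b)) P)" for P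
      using P(2) Ratio_pos[OF P(1)] pos[OF P(1)] unfolding cmp[OF P(1)]
      by (simp add: ratio_test_def mult_less_cancel_left1 mult_less_cancel_left2 divide_less_eq)
    show "?f P = 0" if P: "P \<in> profiles A n"
      "pmf (?M T) P < K / real (card ?B) * (\<Sum>b\<in>?B. pmf (?M (H b)) P)" for P
      using P(2) Ratio_pos[OF P(1)] pos[OF P(1)] unfolding cmp[OF P(1)]
      by (simp add: ratio_test_def mult_less_cancel_left1 mult_less_cancel_left2 less_divide_eq)
    show "(\<Sum>b\<in>?B. size_at ?M g (H b)) \<le> (\<Sum>b\<in>?B. size_at ?M ?f (H b))"
      using g_size f_size by (intro sum_mono) simp
  qed (use A K g \<Gamma> set_M in \<open>auto simp: finite_profiles is_test_def ratio_test_def\<close>)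
qed

theorem theorem8:
  fixes A :: "'a set" and a :: 'a and n :: nat and \<phi> \<alpha> :: real
  assumes "finite A" and "card A \<ge> 2" and "n \<ge> 2"
    and "0 < \<phi>" and "\<phi> < 1"
    and "a \<in> A"
    and "0 < \<alpha>" and "\<alpha> < 1"
  shows
    "(\<exists>K \<Gamma>. \<Gamma> \<in> {0..1} \<and>
        test_size (condorcet_model A \<phi> n) (prefs A - prefs_top A a) (ratio_test A \<phi> a K \<Gamma>) = \<alpha>)
     \<and> (\<forall>K \<Gamma>. \<Gamma> \<in> {0..1} \<and>
        test_size (condorcet_model A \<phi> n) (prefs A - prefs_top A a) (ratio_test A \<phi> a K \<Gamma>) = \<alpha>
        \<longrightarrow> is_UMP_test (profiles A n) (condorcet_model A \<phi> n)
              (prefs A - prefs_top A a) (prefs_top A a) \<alpha> (ratio_test A \<phi> a K \<Gamma>))"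
proof (intro conjI allI impI)
  obtain T where T: "T \<in> prefs_top A a" using prefs_top_nonempty[OF \<open>a \<in> A\<close>] .
  obtain b where b: "b \<in> A - {a}"
    using opponents_nonempty[OF assms(2)] by blast
  let ?W = "reverse_pair a b ` T"
  have "finite (set_pmf (condorcet_model A \<phi> n ?W))"
    using assms by (simp add: set_condorcet_model finite_profiles)
  from threshold_exists[OF this assms(7,8), where R = "Ratio A \<phi> a"]
  obtain K \<Gamma> where \<Gamma>: "\<Gamma> \<in> {0..1}"
    and E: "measure_pmf.expectation (condorcet_model A \<phi> n ?W)
      (\<lambda>P. if Ratio A \<phi> a P > K then 1 else if Ratio A \<phi> a P < K then 0 else \<Gamma>) = \<alpha>"
    by blast
  have "size_at (condorcet_model A \<phi> n) (ratio_test A \<phi> a K \<Gamma>) ?W = \<alpha>"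
    using E unfolding size_at_def ratio_test_def .
  then have "test_size (condorcet_model A \<phi> n) (prefs A - prefs_top A a) (ratio_test A \<phi> a K \<Gamma>) = \<alpha>"
    using test_size_ratio_test[OF assms(1,2,4,5,6) \<Gamma> T b, of n K] by simp
  with \<Gamma> show "\<exists>K \<Gamma>. \<Gamma> \<in> {0..1} \<and>
      test_size (condorcet_model A \<phi> n) (prefs A - prefs_top A a) (ratio_test A \<phi> a K \<Gamma>) = \<alpha>"
    by blast
next
  fix K \<Gamma>
  assume *: "\<Gamma> \<in> {0..1} \<and>
    test_size (condorcet_model A \<phi> n) (prefs A - prefs_top A a) (ratio_test A \<phi> a K \<Gamma>) = \<alpha>"
  then have "is_test (profiles A n) (ratio_test A \<phi> a K \<Gamma>)"
    by (auto simp: is_test_def ratio_test_def)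
  with * show "is_UMP_test (profiles A n) (condorcet_model A \<phi> n) (prefs A - prefs_top A a)
      (prefs_top A a) \<alpha> (ratio_test A \<phi> a K \<Gamma>)"
    unfolding is_UMP_test_def using ratio_test_most_powerful[OF assms(1,2,4,5,6)] assms(8) by blast
qed

end
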